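(* Let $m\ge3$ be an odd integer, let $(G,+,0)$ be an abelian group whose exponent divides $m-1$, let $u,v\in G$, and put $d=u-v$. Then $F_m(G;u,v)$ is binary reducible if and only if $d=0$. More generally, for every subgroup $N\le G$ and all $\varepsilon,\delta\in\{0,1\}$, $$F_m(G;u,v)/\theta_N^{\varepsilon,\delta}\text{ is binary reducible}\iff \varepsilon=1\ \text{ or }\ \delta=1\ \text{ or }\ d\in N.$$ Consequently $F_m(G;u,v)$ is quotient-critically irreducible if and only if $$d\neq0\quad\text{and}\quad d\in N\text{ for every nonzero subgroup }N\le G.\qquad( * )$$ If $G$ is finite, condition $( * )$ holds exactly when $G$ is a cyclic group of order $p^k$ for some prime $p$ and $k\ge1$, and $d$ has order $p$.
   Context: The exponent of $G$ divides $m-1$ means $(m-1)g=0$ for all $g\in G$. Let $X(G)=G\mathbin{\dot\cup}\{a,b\}$ and define $\tau:X(G)\to G$ by $\tau(a)=u$, $\tau(b)=v$, $\tau(g)=g$ for $g\in G$. The operation $F_m=F_m(G;u,v):X(G)^m\to X(G)$ is: $F_m(x_1,\dots,x_m)=a$ if $x_1=\dots=x_m=a$; $=b$ if $x_1=\dots=x_m=b$; and $=\tau(x_1)+\dots+\tau(x_m)$ otherwise. It is an associative $m$-ary operation (an $m$-ary semigroup). For a subgroup $N\le G$ and $\varepsilon,\delta\in\{0,1\}$, $\theta_N^{\varepsilon,\delta}$ is the following equivalence on $X(G)$: its restriction to $G$ is congruence modulo $N$; if $\varepsilon=1$, $a$ is adjoined to the class of $u+N$, otherwise $\{a\}$ is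 a singleton class; if $\delta=1$, $b$ is adjoined to the class of $v+N$, otherwise $\{b\}$ is a singleton class. These are congruences of $F_m(G;u,v)$ (and all of its congruences are of this form), so the quotient $m$-ary semigroup $F_m(G;u,v)/\theta_N^{\varepsilon,\delta}$ is defined. An $m$-ary semigroup $(X,F)$ is binary reducible if there is an associative binary operation $g:X^2\to X$ whose $m$-fold product equals $F$: $F(x_1,\dots,x_m)=g(\cdots g(g(x_1,x_2),x_3)\cdots,x_m)$ for all $x_i\in X$; otherwise it is irreducible. An irreducible $m$-ary semigroup is quotient-critically irreducible if each quotient by a congruence other than the identity congruence is binary reducible. *)

theory Defs
  imports "HOL-Algebra.Elementary_Groups" "HOL-Algebra.Multiplicative_Group"
    "HOL-Computational_Algebra.Primes"
begin

section \<open>m-ary semigroups\<close>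

text \<open>
  An \<open>m\<close>-ary operation on a set \<open>S\<close> is a function on lists, considered only on the
  lists of length \<open>m\<close> with entries in \<open>S\<close>.
\<close>

definition nary_tuples :: "'x set \<Rightarrow> nat \<Rightarrow> 'x list set" where
  "nary_tuples S m = {xs. length xs = m \<and> set xs \<subseteq> S}"

text \<open>
  Associativity: in a word of length \<open>2 * m - 1\<close> the inner operation may be applied to any
  of the \<open>m\<close> blocks of \<open>m\<close> consecutive letters.
\<close>

definition nary_semigroup :: "'x set \<Rightarrow> nat \<Rightarrow> ('x list \<Rightarrow> 'x) \<Rightarrow> bool" where
  "nary_semigroup S m F \<longleftrightarrow>
     (\<forall>xs \<in> nary_tuples S m. F xs \<in> S) \<and>
     (\<forall>zs \<in> nary_tuples S (2 * m - 1). \<forall>i < m. \<forall>j < m.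
        F (take i zs @ F (take m (drop i zs)) # drop (i + m) zs) =
        F (take j zs @ F (take m (drop j zs)) # drop (j + m) zs))"

definition binary_reducible :: "'x set \<Rightarrow> nat \<Rightarrow> ('x list \<Rightarrow> 'x) \<Rightarrow> bool" where
  "binary_reducible S m F \<longleftrightarrow>
     (\<exists>g. (\<forall>x \<in> S. \<forall>y \<in> S. g x y \<in> S) \<and>
          (\<forall>x \<in> S. \<forall>y \<in> S. \<forall>z \<in> S. g (g x y) z = g x (g y z)) \<and>
          (\<forall>xs \<in> nary_tuples S m. F xs = foldl g (hd xs) (tl xs)))"

definition irreducible_nary_semigroup :: "'x set \<Rightarrow> nat \<Rightarrow> ('x list \<Rightarrow> 'x) \<Rightarrow> bool" where
  "irreducible_nary_semigroup S m F \<longleftrightarrow> nary_semigroup S m F \<and> \<not> binary_reducible S m F"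

definition nary_congruence :: "'x set \<Rightarrow> nat \<Rightarrow> ('x list \<Rightarrow> 'x) \<Rightarrow> ('x \<times> 'x) set \<Rightarrow> bool" where
  "nary_congruence S m F r \<longleftrightarrow>
     equiv S r \<and>
     (\<forall>xs \<in> nary_tuples S m. \<forall>ys \<in> nary_tuples S m.
        list_all2 (\<lambda>x y. (x, y) \<in> r) xs ys \<longrightarrow> (F xs, F ys) \<in> r)"

text \<open>
  The operation induced on \<open>S // r\<close>, in the style of \<open>UN_equiv_class\<close>: the union of the
  classes of \<open>F xs\<close> over all choices \<open>xs\<close> of representatives. For a congruence all these
  classes coincide, see \<open>quotient_op_eq\<close> below.
\<close>

definition quotient_op :: "('x \<times> 'x) set \<Rightarrow> ('x list \<Rightarrow> 'x) \<Rightarrow> 'x set list \<Rightarrow> 'x set" where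
  "quotient_op r F Cs = (\<Union>xs \<in> listset Cs. r `` {F xs})"

definition quotient_critically_irreducible :: "'x set \<Rightarrow> nat \<Rightarrow> ('x list \<Rightarrow> 'x) \<Rightarrow> bool" where
  "quotient_critically_irreducible S m F \<longleftrightarrow>
     irreducible_nary_semigroup S m F \<and>
     (\<forall>r. nary_congruence S m F r \<and> r \<noteq> Id_on S \<longrightarrow>
          binary_reducible (S // r) m (quotient_op r F))"

lemma listset_iff: "xs \<in> listset Cs \<longleftrightarrow> list_all2 (\<in>) xs Cs"
  by (induction Cs arbitrary: xs) (auto simp: set_Cons_def list_all2_Cons2)

lemma quotient_op_eq:
  assumes "nary_congruence S m F r" and "xs \<in> nary_tuples S m"
  shows "quotient_op r F (map (\<lambda>x. r `` {x}) xs) = r `` {F xs}"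
proof -
  have r: "equiv S r" using assms(1) by (simp add: nary_congruence_def)
  have self: "xs \<in> listset (map (\<lambda>x. r `` {x}) xs)"
    using assms(2) r equiv_class_self[OF r]
    by (auto simp: listset_iff list_all2_conv_all_nth nary_tuples_def subset_iff)
  have "r `` {F ys} = r `` {F xs}" if ys: "ys \<in> listset (map (\<lambda>x. r `` {x}) xs)" for ys
  proof -
    have l: "list_all2 (\<lambda>x y. (x, y) \<in> r) xs ys"
      using ys by (auto simp: listset_iff list_all2_conv_all_nth)
    have "set ys \<subseteq> S"
    proof
      fix y assume "y \<in> set ys"
      then obtain i where "i < length ys" "y = ys ! i" by (metis in_set_conv_nth)
      then have "(xs ! i, y) \<in> r" using l by (auto simp: list_all2_conv_all_nth)
      then show "y \<in> S" using r by (auto simp: equiv_def)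
    qed
    then have "ys \<in> nary_tuples S m"
      using l assms(2) by (auto simp: nary_tuples_def list_all2_lengthD)
    then have "(F xs, F ys) \<in> r" using assms l by (auto simp: nary_congruence_def)
    then show ?thesis using equiv_class_eq[OF r] by metis
  qed
  then show ?thesis using self unfolding quotient_op_def by blast
qed


section \<open>The operation \<open>F\<^sub>m(G; u, v)\<close>\<close>

text \<open>
  The abelian group is written multiplicatively, as a \<open>comm_group\<close> of \<open>HOL-Algebra\<close>:
  \<open>\<otimes>\<close>, \<open>\<one>\<close> and \<open>inv\<close> are addition, zero and negation.
\<close>

datatype 'g point = Elem 'g | Pt_a | Pt_b

definition points :: "('g, 'r) monoid_scheme \<Rightarrow> 'g point set" where
  "points G = Elem ` carrier G \<union> {Pt_a, Pt_b}"

fun tau :: "'g \<Rightarrow> 'g \<Rightarrow> 'g point \<Rightarrow> 'g" where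
  "tau u v Pt_a = u"
| "tau u v Pt_b = v"
| "tau u v (Elem g) = g"

text \<open>The arity \<open>m\<close> is the length of the argument list.\<close>

definition F_op :: "('g, 'r) monoid_scheme \<Rightarrow> 'g \<Rightarrow> 'g \<Rightarrow> 'g point list \<Rightarrow> 'g point" where
  "F_op G u v xs =
     (if \<forall>x \<in> set xs. x = Pt_a then Pt_a
      else if \<forall>x \<in> set xs. x = Pt_b then Pt_b
      else Elem (foldr (\<lambda>x s. tau u v x \<otimes>\<^bsub>G\<^esub> s) xs \<one>\<^bsub>G\<^esub>))"

text \<open>
  The classes of \<open>\<theta>\<^sub>N\<^bsup>\<epsilon>,\<delta>\<^esup>\<close>; \<open>\<epsilon>\<close> and \<open>\<delta>\<close> are Booleans. If both hold and \<open>u\<close>, \<open>v\<close> lie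
  in the same coset, then \<open>a\<close> and \<open>b\<close> are adjoined to the same class.
\<close>

definition theta_classes ::
    "('g, 'r) monoid_scheme \<Rightarrow> 'g \<Rightarrow> 'g \<Rightarrow> 'g set \<Rightarrow> bool \<Rightarrow> bool \<Rightarrow> 'g point set set" where
  "theta_classes G u v N \<epsilon> \<delta> =
     {Elem ` C \<union> (if \<epsilon> \<and> C = N #>\<^bsub>G\<^esub> u then {Pt_a} else {})
               \<union> (if \<delta> \<and> C = N #>\<^bsub>G\<^esub> v then {Pt_b} else {}) | C. C \<in> rcosets\<^bsub>G\<^esub> N}
     \<union> (if \<epsilon> then {} else {{Pt_a}})
     \<union> (if \<delta> then {} else {{Pt_b}})"

definition theta ::
    "('g, 'r) monoid_scheme \<Rightarrow> 'g \<Rightarrow> 'g \<Rightarrow> 'g set \<Rightarrow> bool \<Rightarrow> bool \<Rightarrow> ('g point \<times> 'g point) set" where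
  "theta G u v N \<epsilon> \<delta> = {(x, y). \<exists>K \<in> theta_classes G u v N \<epsilon> \<delta>. x \<in> K \<and> y \<in> K}"

section \<open>Well-definedness\<close>

context comm_group
begin

lemma tau_closed:
  "x \<in> points G \<Longrightarrow> u \<in> carrier G \<Longrightarrow> v \<in> carrier G \<Longrightarrow> tau u v x \<in> carrier G"
  by (auto simp: points_def)

lemma foldr_tau_closed:
  assumes "set xs \<subseteq> points G" "u \<in> carrier G" "v \<in> carrier G"
  shows "foldr (\<lambda>x s. tau u v x \<otimes> s) xs \<one> \<in> carrier G"
  using assms(1) by (induction xs) (auto simp: tau_closed assms)

lemma F_op_closed:
  assumes "set xs \<subseteq> points G" "u \<in> carrier G" "v \<in> carrier G"
  shows "F_op G u v xs \<in> points G"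
  using foldr_tau_closed[OF assms] by (auto simp: F_op_def points_def)

lemma foldr_tau_append:
  assumes "set xs \<subseteq> points G" "set ys \<subseteq> points G" "u \<in> carrier G" "v \<in> carrier G"
  shows "foldr (\<lambda>x s. tau u v x \<otimes> s) (xs @ ys) \<one> =
    foldr (\<lambda>x s. tau u v x \<otimes> s) xs \<one> \<otimes> foldr (\<lambda>x s. tau u v x \<otimes> s) ys \<one>"
  using assms(1)
  by (induction xs) (simp_all add: foldr_tau_closed tau_closed m_assoc assms)

lemma foldr_tau_const:
  assumes "\<forall>x \<in> set xs. x = c" "c \<in> points G" "u \<in> carrier G" "v \<in> carrier G"
  shows "foldr (\<lambda>x s. tau u v x \<otimes> s) xs \<one> = tau u v c [^] length xs"
  using assms(1)
  by (induction xs) (simp_all add: tau_closed assms m_comm)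

lemma tau_F_op:
  assumes "set xs \<subseteq> points G" "length xs = m" "m \<ge> 1" "u \<in> carrier G" "v \<in> carrier G"
    and exponent: "\<forall>g \<in> carrier G. g [^] (m - 1) = \<one>"
  shows "tau u v (F_op G u v xs) = foldr (\<lambda>x s. tau u v x \<otimes> s) xs \<one>"
proof -
  have pow: "g [^] m = g" if "g \<in> carrier G" for g
    using exponent that nat_pow_Suc[of g "m - 1"] \<open>m \<ge> 1\<close> by simp
  show ?thesis
    using foldr_tau_const[of xs Pt_a u v] foldr_tau_const[of xs Pt_b u v] assms pow
    by (auto simp: F_op_def points_def)
qed

lemma F_op_eq_iff:
  "xs \<noteq> [] \<Longrightarrow> F_op G u v xs = Pt_a \<longleftrightarrow> (\<forall>x \<in> set xs. x = Pt_a)"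
  "xs \<noteq> [] \<Longrightarrow> F_op G u v xs = Pt_b \<longleftrightarrow> (\<forall>x \<in> set xs. x = Pt_b)"
  by (cases xs; auto simp: F_op_def)+

lemma F_op_nested:
  assumes "set (xs @ ys @ zs) \<subseteq> points G" "length ys = m" "m \<ge> 1"
    and "u \<in> carrier G" "v \<in> carrier G"
    and "\<forall>g \<in> carrier G. g [^] (m - 1) = \<one>"
  shows "F_op G u v (xs @ F_op G u v ys # zs) = F_op G u v (xs @ ys @ zs)"
proof -
  have ne: "ys \<noteq> []" using assms by auto
  have c: "F_op G u v ys \<in> points G" using assms by (simp add: F_op_closed)
  have "foldr (\<lambda>x s. tau u v x \<otimes> s) (xs @ F_op G u v ys # zs) \<one> =
        foldr (\<lambda>x s. tau u v x \<otimes> s) (xs @ ys @ zs) \<one>"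
    using assms c
    by (simp add: foldr_tau_append tau_F_op[of ys m] del: foldr_append)
  moreover have "(\<forall>x \<in> set (xs @ F_op G u v ys # zs). x = Pt_a) \<longleftrightarrow>
      (\<forall>x \<in> set (xs @ ys @ zs). x = Pt_a)"
    using F_op_eq_iff(1)[OF ne, of u v] by auto
  moreover have "(\<forall>x \<in> set (xs @ F_op G u v ys # zs). x = Pt_b) \<longleftrightarrow>
      (\<forall>x \<in> set (xs @ ys @ zs). x = Pt_b)"
    using F_op_eq_iff(2)[OF ne, of u v] by auto
  ultimately show ?thesis unfolding F_op_def by presburger
qed

theorem nary_semigroup_F_op:
  assumes "m \<ge> 1" "u \<in> carrier G" "v \<in> carrier G"
    and "\<forall>g \<in> carrier G. g [^] (m - 1) = \<one>"
  shows "nary_semigroup (points G) m (F_op G u v)"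
proof -
  have "F_op G u v (take i zs @ F_op G u v (take m (drop i zs)) # drop (i + m) zs) = F_op G u v zs"
    if zs: "zs \<in> nary_tuples (points G) (2 * m - 1)" and i: "i < m" for zs i
  proof -
    have eq: "take i zs @ take m (drop i zs) @ drop (i + m) zs = zs"
      by (metis add.commute append_take_drop_id drop_drop)
    have "length (take m (drop i zs)) = m" using zs i by (auto simp: nary_tuples_def)
    moreover have "set (take i zs @ take m (drop i zs) @ drop (i + m) zs) \<subseteq> points G"
      unfolding eq using zs by (simp add: nary_tuples_def)
    ultimately have "F_op G u v (take i zs @ F_op G u v (take m (drop i zs)) # drop (i + m) zs) =
        F_op G u v (take i zs @ take m (drop i zs) @ drop (i + m) zs)"
      using F_op_nested assms by metis
    then show ?thesis by (simp only: eq)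
  qed
  then show ?thesis
    using assms by (auto simp: nary_semigroup_def nary_tuples_def F_op_closed)
qed

lemma theta_iff:
  assumes "subgroup N G" "u \<in> carrier G" "v \<in> carrier G"
  shows "(x, y) \<in> theta G u v N \<epsilon> \<delta> \<longleftrightarrow>
    x \<in> points G \<and> y \<in> points G \<and>
    (x = y \<or> (N #> tau u v x = N #> tau u v y \<and>
       (\<epsilon> \<or> x \<noteq> Pt_a \<and> y \<noteq> Pt_a) \<and> (\<delta> \<or> x \<noteq> Pt_b \<and> y \<noteq> Pt_b)))"
proof -
  have in_coset: "g \<in> C \<longleftrightarrow> g \<in> carrier G \<and> C = N #> g" if "C \<in> rcosets N" for g C
    using that assms repr_independence rcos_self subgroup.subset[OF assms(1)]
    unfolding RCOSETS_def by (auto dest: r_coset_subset_G[THEN subsetD, rotated 2])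
  have cosetI: "N #> g \<in> rcosets N" if "g \<in> carrier G" for g
    using that by (auto simp: RCOSETS_def)
  define A where "A C = Elem ` C \<union> (if \<epsilon> \<and> C = N #> u then {Pt_a} else {})
    \<union> (if \<delta> \<and> C = N #> v then {Pt_b} else {})" for C
  have A: "Elem g \<in> A C \<longleftrightarrow> g \<in> C" "Pt_a \<in> A C \<longleftrightarrow> \<epsilon> \<and> C = N #> u"
    "Pt_b \<in> A C \<longleftrightarrow> \<delta> \<and> C = N #> v" for g C
    by (auto simp: A_def)
  have th: "(x, y) \<in> theta G u v N \<epsilon> \<delta> \<longleftrightarrow>
      (\<exists>C \<in> rcosets N. x \<in> A C \<and> y \<in> A C)
      \<or> (\<not> \<epsilon> \<and> x = Pt_a \<and> y = Pt_a) \<or> (\<not> \<delta> \<and> x = Pt_b \<and> y = Pt_b)"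
    unfolding theta_def theta_classes_def A_def[symmetric] by auto
  show ?thesis
    unfolding th points_def
    by (cases x; cases y) (auto simp: A in_coset cosetI assms)
qed

theorem nary_congruence_theta:
  assumes "m \<ge> 1" "u \<in> carrier G" "v \<in> carrier G" "subgroup N G"
    and "\<forall>g \<in> carrier G. g [^] (m - 1) = \<one>"
  shows "nary_congruence (points G) m (F_op G u v) (theta G u v N \<epsilon> \<delta>)"
proof -
  note iff = theta_iff[OF assms(4,2,3), of _ _ \<epsilon> \<delta>]
  have equiv: "equiv (points G) (theta G u v N \<epsilon> \<delta>)"
    by (rule equivI) (auto simp: iff refl_on_def sym_def trans_def)
  have N: "N \<lhd> G" using assms(4) by (rule subgroup_imp_normal)
  have cosets: "N #> foldr (\<lambda>x s. tau u v x \<otimes> s) xs \<one> = N #> foldr (\<lambda>x s. tau u v x \<otimes> s) ys \<one>"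
    if "list_all2 (\<lambda>x y. (x, y) \<in> theta G u v N \<epsilon> \<delta>) xs ys"
      "set xs \<subseteq> points G" "set ys \<subseteq> points G" for xs ys
    using that
  proof (induction rule: list_all2_induct)
    case (Cons x xs y ys)
    then have "N #> tau u v x = N #> tau u v y" by (auto simp: iff)
    then show ?case
      using Cons normal.rcos_sum[OF N, symmetric] assms
      by (simp add: tau_closed foldr_tau_closed)
  qed simp
  have "(F_op G u v xs, F_op G u v ys) \<in> theta G u v N \<epsilon> \<delta>"
    if xs: "xs \<in> nary_tuples (points G) m" and ys: "ys \<in> nary_tuples (points G) m"
      and l: "list_all2 (\<lambda>x y. (x, y) \<in> theta G u v N \<epsilon> \<delta>) xs ys" for xs ys
  proof -
    have ne: "xs \<noteq> []" "ys \<noteq> []" using xs ys assms(1) by (auto simp: nary_tuples_def)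
    have "F_op G u v xs = c \<longleftrightarrow> F_op G u v ys = c"
      if "c = Pt_a \<and> \<not> \<epsilon> \<or> c = Pt_b \<and> \<not> \<delta>" for c
    proof -
      have "(\<forall>x \<in> set xs. x = c) \<longleftrightarrow> (\<forall>y \<in> set ys. y = c)"
        using l
      proof (induction rule: list_all2_induct)
        case (Cons x xs y ys)
        then have "x = c \<longleftrightarrow> y = c" using that by (auto simp: iff)
        then show ?case using Cons by simp
      qed simp
      then show ?thesis using that F_op_eq_iff ne by metis
    qed
    from this[of Pt_a] this[of Pt_b] show ?thesis
      using xs ys cosets[OF l] assms
      by (auto simp: iff F_op_closed tau_F_op nary_tuples_def)
  qed
  then show ?thesis using equiv by (simp add: nary_congruence_def)
qed

end

end

theory Submission
  imports Defs
begin

text \<open>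
  Suppose a binary operation \<open>\<cdot>\<close> reduces \<open>F\<^sub>m(G; u, v)\<close>. Since \<open>a\<close> is a value of \<open>F\<close> only at
  \<open>(a, \<dots>, a)\<close>, it must be idempotent: \<open>F(a, a \<cdot> a, \<dots>, a \<cdot> a)\<close> is the power \<open>a\<^bsup>2m-1\<^esup> = a\<close>. The
  same holds for \<open>b\<close>, so both \<open>F(a, \<dots>, a, b) = v\<close> and \<open>F(a, b, \<dots>, b) = u\<close> equal \<open>a \<cdot> b\<close>, and \<open>u = v\<close>.
  Conversely \<open>x + y - w\<close>, for a suitable \<open>w \<in> {u, v}\<close>, reduces the operation. Both arguments apply
  to the quotients by \<open>\<theta>\<close> as well. A congruence relating \<open>a\<close> to another point relates \<open>a\<close> to \<open>u\<close>, hence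
  every congruence is some \<open>\<theta>\<close>, and the criterion for critical irreducibility follows.
\<close>

section \<open>An obstruction to binary reducibility\<close>

text \<open>The carrier and the two points are arbitrary, so that the argument also covers a
  quotient in which the classes of \<open>Pt_a\<close> and \<open>Pt_b\<close> play the roles of
  \<open>a\<close> and \<open>b\<close>.\<close>

lemma binary_reducible_distinguished:
  assumes red: "binary_reducible S m F" and m: "m \<ge> 2" and "a \<in> S" "b \<in> S"
    and a: "\<And>xs. xs \<in> nary_tuples S m \<Longrightarrow> F xs = a \<longleftrightarrow> set xs \<subseteq> {a}"
    and b: "\<And>xs. xs \<in> nary_tuples S m \<Longrightarrow> F xs = b \<longleftrightarrow> set xs \<subseteq> {b}"
  shows "F (replicate (m - 1) a @ [b]) = F (a # replicate (m - 1) b)"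
proof -
  obtain g where closed: "\<And>x y. x \<in> S \<Longrightarrow> y \<in> S \<Longrightarrow> g x y \<in> S"
    and assoc: "\<And>x y z. x \<in> S \<Longrightarrow> y \<in> S \<Longrightarrow> z \<in> S \<Longrightarrow> g (g x y) z = g x (g y z)"
    and F: "\<And>xs. xs \<in> nary_tuples S m \<Longrightarrow> F xs = foldl g (hd xs) (tl xs)"
    using red unfolding binary_reducible_def by blast
  have idem: "g c c = c"
    if c: "c \<in> S" and F_c: "\<And>xs. xs \<in> nary_tuples S m \<Longrightarrow> F xs = c \<longleftrightarrow> set xs \<subseteq> {c}" for c
  proof -
    \<comment> \<open>\<open>pw n\<close> is the power of \<open>c\<close> with \<open>n + 1\<close>
      factors; hence the additional 1 in the exponent laws below.\<close>
    define pw where "pw n = foldl g c (replicate n c)" for n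
    have pw_0: "pw 0 = c" by (simp add: pw_def)
    have pw_Suc: "pw (Suc n) = g (pw n) c" for n
      by (simp only: pw_def replicate_Suc replicate_append_same[symmetric] foldl_append foldl.simps)
    have pw_closed: "pw n \<in> S" for n
      by (induction n) (simp_all add: pw_0 pw_Suc c closed)
    have pw_add: "g (pw i) (pw j) = pw (i + j + 1)" for i j
      by (induction j) (simp_all add: pw_0 pw_Suc c pw_closed assoc[symmetric])
    have pw_foldl: "foldl g (pw i) (replicate k (pw j)) = pw (i + k * (j + 1))" for i j k
      by (induction k arbitrary: i) (simp_all add: pw_add algebra_simps)
    have "replicate m c \<in> nary_tuples S m" using c by (auto simp: nary_tuples_def)
    then have "F (replicate m c) = c"
      "F (replicate m c) = foldl g (hd (replicate m c)) (tl (replicate m c))"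
      by (auto simp: F_c simp del: tl_replicate intro!: F)
    then have pw_m: "pw (m - 1) = c" using m by (simp add: pw_def)
    \<comment> \<open>The value of \<open>F\<close> on \<open>(c, c\<^sup>2, \<dots>, c\<^sup>2)\<close> is \<open>c\<^bsup>2m-1\<^esup> = c\<^bsup>m\<^esup>c\<^bsup>m-1\<^esup> = c\<close>.\<close>
    have tup: "c # replicate (m - 1) (pw 1) \<in> nary_tuples S m"
      using c m pw_closed by (auto simp: nary_tuples_def)
    have "F (c # replicate (m - 1) (pw 1)) = pw ((m - 1) + (m - 2) + 1)"
    proof -
      have "0 + (m - 1) * (1 + 1) = (m - 1) + (m - 2) + 1" using m by arith
      then show ?thesis using F[OF tup] pw_foldl[of 0 "m - 1" 1] by (simp only: pw_0 list.sel)
    qed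
    also have "\<dots> = g c (pw (m - 2))" by (simp only: pw_add[symmetric] pw_m)
    also have "\<dots> = pw (m - 1)"
    proof -
      have "0 + (m - 2) + 1 = m - 1" using m by arith
      then show ?thesis using pw_add[of 0 "m - 2"] by (simp only: pw_0)
    qed
    finally have "set (c # replicate (m - 1) (pw 1)) \<subseteq> {c}" using F_c[OF tup] pw_m by simp
    then have "pw 1 = c" using m by auto
    then show ?thesis by (simp add: pw_def)
  qed
  have aa: "g a a = a" using idem[OF \<open>a \<in> S\<close>] a by blast
  have bb: "g b b = b" using idem[OF \<open>b \<in> S\<close>] b by blast
  have fa: "foldl g a (replicate k a) = a" for k by (induction k) (simp_all add: aa)
  have fb: "foldl g (g a b) (replicate k b) = g a b" for k
    by (induction k) (simp_all add: assoc \<open>a \<in> S\<close> \<open>b \<in> S\<close> bb)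
  obtain k where k: "m = Suc (Suc k)" using m by (metis add_2_eq_Suc le_Suc_ex)
  have "replicate (m - 1) a @ [b] \<in> nary_tuples S m" "a # replicate (m - 1) b \<in> nary_tuples S m"
    using \<open>a \<in> S\<close> \<open>b \<in> S\<close> m by (auto simp: nary_tuples_def)
  then show ?thesis by (simp add: F k fa fb aa)
qed

section \<open>Quotients and binary reducibility\<close>

lemma nary_tuples_quotient:
  assumes "Cs \<in> nary_tuples (S // r) m"
  obtains xs where "xs \<in> nary_tuples S m" "Cs = map (\<lambda>x. r `` {x}) xs"
proof -
  have "Cs \<in> lists ((\<lambda>x. r `` {x}) ` S)"
    using assms by (auto simp: nary_tuples_def quotient_def)
  then obtain xs where "xs \<in> lists S" "Cs = map (\<lambda>x. r `` {x}) xs"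
    unfolding lists_image by blast
  then show thesis using assms that by (auto simp: nary_tuples_def)
qed

text \<open>An operation \<open>h\<close> on representatives descends to the classes, so it only has
  to be associative and to reduce \<open>F\<close> up to \<open>r\<close>. This leaves room for
  operations such as x + y - w, with exceptional values at a and b, that are associative only modulo
  a subgroup.\<close>

lemma binary_reducible_quotientI:
  assumes cong: "nary_congruence S m F r" and m: "m \<ge> 1"
    and closed: "\<And>x y. x \<in> S \<Longrightarrow> y \<in> S \<Longrightarrow> h x y \<in> S"
    and resp: "\<And>x x' y y'. (x, x') \<in> r \<Longrightarrow> (y, y') \<in> r \<Longrightarrow> (h x y, h x' y') \<in> r"
    and assoc: "\<And>x y z. x \<in> S \<Longrightarrow> y \<in> S \<Longrightarrow> z \<in> S \<Longrightarrow> (h (h x y) z, h x (h y z)) \<in> r"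
    and red: "\<And>xs. xs \<in> nary_tuples S m \<Longrightarrow> (F xs, foldl h (hd xs) (tl xs)) \<in> r"
  shows "binary_reducible (S // r) m (quotient_op r F)"
proof -
  have r: "equiv S r" using cong by (simp add: nary_congruence_def)
  define g where "g C D = (\<Union>x \<in> C. \<Union>y \<in> D. r `` {h x y})" for C D
  have "congruent2 r r (\<lambda>x y. r `` {h x y})"
    by (rule congruent2I') (use resp equiv_class_eq[OF r] in blast)
  then have g: "g (r `` {x}) (r `` {y}) = r `` {h x y}" if "x \<in> S" "y \<in> S" for x y
    unfolding g_def using UN_equiv_class2[OF r r] that by blast
  have fold: "foldl g (r `` {x}) (map (\<lambda>x. r `` {x}) xs) = r `` {foldl h x xs}"
    if "x \<in> S" "set xs \<subseteq> S" for x xs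
    using that by (induction xs arbitrary: x) (simp_all add: g closed)
  have "quotient_op r F Cs = foldl g (hd Cs) (tl Cs)" if "Cs \<in> nary_tuples (S // r) m" for Cs
  proof -
    obtain xs where xs: "xs \<in> nary_tuples S m" and Cs: "Cs = map (\<lambda>x. r `` {x}) xs"
      using \<open>Cs \<in> _\<close> by (rule nary_tuples_quotient)
    obtain y ys where y: "xs = y # ys" using xs m by (cases xs) (auto simp: nary_tuples_def)
    show ?thesis
      using xs equiv_class_eq[OF r red[OF xs]]
      unfolding Cs quotient_op_eq[OF cong xs] by (simp add: y fold nary_tuples_def)
  qed
  moreover have "g C D \<in> S // r" if "C \<in> S // r" "D \<in> S // r" for C D
    using that by (auto elim!: quotientE simp: g closed intro!: quotientI)
  moreover have "g (g C D) E = g C (g D E)" if "C \<in> S // r" "D \<in> S // r" "E \<in> S // r" for C D E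
    using that by (elim quotientE) (simp add: g closed equiv_class_eq[OF r assoc])
  ultimately show ?thesis
    unfolding binary_reducible_def by (intro exI[of _ g] conjI ballI) auto
qed

text \<open>Each tuple is entrywise related to itself, so \<open>F xs\<close> is related to itself,
  and \<open>r\<close> relates only members of \<open>S\<close>.\<close>

lemma nary_congruence_closed:
  assumes "nary_congruence S m F r" "xs \<in> nary_tuples S m"
  shows "F xs \<in> S"
proof -
  have "\<forall>x \<in> set xs. (x, x) \<in> r"
    using assms by (auto simp: nary_congruence_def nary_tuples_def equiv_def refl_on_def)
  then have "list_all2 (\<lambda>x y. (x, y) \<in> r) xs xs" by (simp add: list_all2_same)
  then have "(F xs, F xs) \<in> r" using assms by (simp add: nary_congruence_def)
  then show ?thesis using assms(1) by (auto simp: nary_congruence_def equiv_def)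
qed

text \<open>The classes of the identity are singletons, so x \<mapsto> {x} transports a reducing
  operation in either direction. This turns a statement about all quotients into one about
  \<open>F\<close> itself.\<close>

lemma binary_reducible_quotient_Id_on:
  assumes cong: "nary_congruence S m F (Id_on S)" and m: "m \<ge> 1"
  shows "binary_reducible (S // Id_on S) m (quotient_op (Id_on S) F) \<longleftrightarrow> binary_reducible S m F"
proof
  have cls: "Id_on S `` {x} = {x}" if "x \<in> S" for x using that by auto
  define Q where "Q = S // Id_on S"
  assume "binary_reducible (S // Id_on S) m (quotient_op (Id_on S) F)"
  then obtain g where closed: "\<forall>C \<in> Q. \<forall>D \<in> Q. g C D \<in> Q"
    and assoc: "\<forall>C \<in> Q. \<forall>D \<in> Q. \<forall>E \<in> Q. g (g C D) E = g C (g D E)"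
    and red: "\<forall>Cs \<in> nary_tuples Q m. quotient_op (Id_on S) F Cs = foldl g (hd Cs) (tl Cs)"
    unfolding Q_def binary_reducible_def by iprover
  have quot: "C \<in> Q \<longleftrightarrow> (\<exists>x \<in> S. C = {x})" for C
    using cls by (auto simp: Q_def quotient_def)
  have sing: "{x} \<in> Q" if "x \<in> S" for x using that by (simp add: quot)
  define h where "h x y = the_elem (g {x} {y})" for x y
  have h: "g {x} {y} = {h x y} \<and> h x y \<in> S" if xy: "x \<in> S" "y \<in> S" for x y
  proof -
    have "g {x} {y} \<in> Q" using closed sing[OF xy(1)] sing[OF xy(2)] by simp
    then obtain z where "z \<in> S" "g {x} {y} = {z}" unfolding quot by (rule bexE)
    then show ?thesis by (simp add: h_def)
  qed
  have fold: "foldl g {x} (map (\<lambda>x. {x}) xs) = {foldl h x xs}" if "x \<in> S" "set xs \<subseteq> S" for x xs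
    using that by (induction xs arbitrary: x) (simp_all add: h)
  have "F xs = foldl h (hd xs) (tl xs)" if xs: "xs \<in> nary_tuples S m" for xs
  proof -
    have sub: "set xs \<subseteq> S" using xs by (simp add: nary_tuples_def)
    obtain y ys where y: "xs = y # ys" using xs m by (cases xs) (auto simp: nary_tuples_def)
    have map: "map (\<lambda>x. Id_on S `` {x}) xs = map (\<lambda>x. {x}) xs" using sub cls by auto
    then have "map (\<lambda>x. {x}) xs \<in> nary_tuples Q m"
      using xs quot by (auto simp: nary_tuples_def)
    then have "{F xs} = foldl g {y} (map (\<lambda>x. {x}) ys)"
      using quotient_op_eq[OF cong xs] red cls nary_congruence_closed[OF cong xs]
      by (simp only: map) (simp add: y)
    then show ?thesis using sub fold by (simp add: y)
  qed
  moreover have "h (h x y) z = h x (h y z)" if "x \<in> S" "y \<in> S" "z \<in> S" for x y z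
    using assoc[THEN bspec, THEN bspec, THEN bspec, OF sing sing sing] that by (simp add: h)
  ultimately show "binary_reducible S m F"
    using h unfolding binary_reducible_def by (intro exI[of _ h] conjI ballI) auto
next
  assume "binary_reducible S m F"
  then obtain g where "\<And>x y. x \<in> S \<Longrightarrow> y \<in> S \<Longrightarrow> g x y \<in> S"
    and "\<And>x y z. x \<in> S \<Longrightarrow> y \<in> S \<Longrightarrow> z \<in> S \<Longrightarrow> g (g x y) z = g x (g y z)"
    and "\<And>xs. xs \<in> nary_tuples S m \<Longrightarrow> F xs = foldl g (hd xs) (tl xs)"
    unfolding binary_reducible_def by blast
  then show "binary_reducible (S // Id_on S) m (quotient_op (Id_on S) F)"
    using nary_congruence_closed[OF cong]
    by (intro binary_reducible_quotientI[OF cong m, of g]) (auto simp: Id_on_iff)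
qed

section \<open>Powers and elements of prime order\<close>

lemma (in group) subgroup_nat_pow_closed:
  assumes "subgroup N G" "x \<in> N"
  shows "x [^] (k::nat) \<in> N"
  using assms by (induction k) (auto simp: subgroup.one_closed subgroup.m_closed)

text \<open>The power of \<open>x\<close> with exponent \<open>ord x\<close> divided by
  \<open>q\<close> has order \<open>q\<close> and stays in \<open>N\<close>.\<close>

lemma (in group) exists_elem_of_prime_order:
  assumes "x \<in> N" "subgroup N G" "prime q" "q dvd ord x" "finite (carrier G)"
  obtains y where "y \<in> N" "ord y = q"
proof -
  have x: "x \<in> carrier G" using assms(1) by (rule subgroup.mem_carrier[OF assms(2)])
  have pos: "ord x > 0" using ord_ge_1[OF assms(5) x] by simp
  obtain k where k: "ord x = q * k" using assms(4) by blast
  then have "ord (x [^] k) = q" using ord_pow[OF x, of k] pos by auto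
  then show thesis by (rule that[OF subgroup_nat_pow_closed[OF assms(2,1)]])
qed

section \<open>Reducibility of the quotients by \<open>theta\<close>\<close>

context comm_group
begin

lemma in_subgroup_iff_rcos_eq:
  assumes "subgroup N G" "x \<in> carrier G" "y \<in> carrier G"
  shows "x \<otimes> inv y \<in> N \<longleftrightarrow> N #> x = N #> y"
proof
  assume "x \<otimes> inv y \<in> N"
  then have "x \<otimes> inv y \<otimes> y \<in> N #> y" by (auto simp: r_coset_def)
  then have "x \<in> N #> y" using assms by (simp add: m_assoc)
  then show "N #> x = N #> y" using repr_independence assms by metis
next
  assume "N #> x = N #> y"
  then have "x \<in> N #> y" using rcos_self assms by metis
  then obtain n where "n \<in> N" "x = n \<otimes> y" by (auto simp: r_coset_def)
  then show "x \<otimes> inv y \<in> N"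
    using assms subgroup.mem_carrier[OF assms(1)] by (simp add: m_assoc)
qed

text \<open>Without the disjunct \<open>x = y\<close> the relation is a conjunction of three
  conditions, on cosets, on a and on b, which can be verified separately.\<close>

lemma theta_iff_of_points:
  assumes "subgroup N G" "u \<in> carrier G" "v \<in> carrier G" "x \<in> points G" "y \<in> points G"
  shows "(x, y) \<in> theta G u v N \<epsilon> \<delta> \<longleftrightarrow> N #> tau u v x = N #> tau u v y \<and>
    (\<epsilon> \<or> (x = Pt_a \<longleftrightarrow> y = Pt_a)) \<and> (\<delta> \<or> (x = Pt_b \<longleftrightarrow> y = Pt_b))"
  using assms(4,5) unfolding theta_iff[OF assms(1-3)] by auto

lemma rcos_mult_cong:
  assumes "subgroup N G" "N #> x = N #> x'" "N #> y = N #> y'"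
    and "x \<in> carrier G" "x' \<in> carrier G" "y \<in> carrier G" "y' \<in> carrier G"
  shows "N #> (x \<otimes> y) = N #> (x' \<otimes> y')"
  using assms normal.rcos_sum[OF subgroup_imp_normal[OF assms(1)]] by metis

lemma binary_reducible_F_op_quotientI:
  assumes N: "subgroup N G" and u: "u \<in> carrier G" and v: "v \<in> carrier G" and m: "m \<ge> 1"
    and exponent: "\<forall>g \<in> carrier G. g [^] (m - 1) = \<one>"
    and d: "\<epsilon> \<or> \<delta> \<or> u \<otimes> inv v \<in> N"
  shows "binary_reducible (points G // theta G u v N \<epsilon> \<delta>) m
    (quotient_op (theta G u v N \<epsilon> \<delta>) (F_op G u v))"
proof -
  \<comment> \<open>\<open>(x, y) \<mapsto> x + y - w\<close> fixes \<open>w\<close>, so it is compatible with \<open>a \<cdot> a = a\<close> if \<open>w\<close> is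
    congruent to \<open>u\<close>, and with \<open>b \<cdot> b = b\<close> if it is congruent to \<open>v\<close>.\<close>
  define w where "w = (if \<epsilon> then v else u)"
  have w: "w \<in> carrier G" and wu: "\<epsilon> \<or> N #> u = N #> w" and wv: "\<delta> \<or> N #> v = N #> w"
    using u v d in_subgroup_iff_rcos_eq[OF N u v] by (auto simp: w_def)
  define h where "h x y = (if \<not> \<epsilon> \<and> x = Pt_a \<and> y = Pt_a then Pt_a
      else if \<not> \<delta> \<and> x = Pt_b \<and> y = Pt_b then Pt_b
      else Elem (tau u v x \<otimes> tau u v y \<otimes> inv w))" for x y
  have tau: "tau u v x \<in> carrier G" if "x \<in> points G" for x
    using that u v by (rule tau_closed)
  have closed: "h x y \<in> points G" if "x \<in> points G" "y \<in> points G" for x y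
    using that w tau by (auto simp: h_def points_def)
  have h_a: "h x y = Pt_a \<longleftrightarrow> x = Pt_a \<and> y = Pt_a" if "\<not> \<epsilon>" for x y
    using that by (auto simp: h_def)
  have h_b: "h x y = Pt_b \<longleftrightarrow> x = Pt_b \<and> y = Pt_b" if "\<not> \<delta>" for x y
    using that by (auto simp: h_def)
  have double: "N #> c = N #> (c \<otimes> c \<otimes> inv w)" if "c \<in> carrier G" "N #> c = N #> w" for c
  proof -
    have "N #> (c \<otimes> (c \<otimes> inv w)) = N #> (c \<otimes> (w \<otimes> inv w))"
      using that w by (intro rcos_mult_cong[OF N]) auto
    then show ?thesis using that w by (simp add: m_assoc)
  qed
  have h: "N #> tau u v (h x y) = N #> (tau u v x \<otimes> tau u v y \<otimes> inv w)" for x y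
    using double[OF u] double[OF v] wu wv by (auto simp: h_def)
  \<comment> \<open>Each application of \<open>h\<close> subtracts \<open>w\<close> once. A product
    of m points uses \<open>h\<close> exactly m - 1 times, so the exponent condition cancels all
    copies of \<open>w\<close> and leaves the sum that defines \<open>F_op\<close>.\<close>
  have fold: "N #> tau u v (foldl h x xs) =
      N #> (tau u v x \<otimes> foldr (\<lambda>x s. tau u v x \<otimes> s) xs \<one> \<otimes> inv w [^] length xs)"
    if "x \<in> points G" "set xs \<subseteq> points G" for x xs
    using that
  proof (induction xs arbitrary: x)
    case (Cons y ys)
    let ?s = "foldr (\<lambda>x s. tau u v x \<otimes> s) ys \<one>"
    have s: "?s \<in> carrier G" using Cons.prems u v by (simp add: foldr_tau_closed)
    have "N #> tau u v (foldl h x (y # ys)) =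
        N #> (tau u v (h x y) \<otimes> (?s \<otimes> inv w [^] length ys))"
      using Cons s w by (simp add: closed tau m_assoc)
    also have "\<dots> = N #> (tau u v x \<otimes> tau u v y \<otimes> inv w \<otimes> (?s \<otimes> inv w [^] length ys))"
      using Cons.prems h s w by (intro rcos_mult_cong[OF N]) (auto simp: tau closed)
    also have "tau u v x \<otimes> tau u v y \<otimes> inv w \<otimes> (?s \<otimes> inv w [^] length ys) =
        tau u v x \<otimes> (tau u v y \<otimes> ?s) \<otimes> (inv w [^] length ys \<otimes> inv w)"
      using Cons.prems s w by (simp add: tau m_ac)
    finally show ?case by simp
  qed (simp add: tau)
  have fold_a: "foldl h x xs = Pt_a \<longleftrightarrow> (\<forall>y \<in> set (x # xs). y = Pt_a)" if "\<not> \<epsilon>" for x xs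
    using that by (induction xs arbitrary: x) (auto simp: h_a)
  have fold_b: "foldl h x xs = Pt_b \<longleftrightarrow> (\<forall>y \<in> set (x # xs). y = Pt_b)" if "\<not> \<delta>" for x xs
    using that by (induction xs arbitrary: x) (auto simp: h_b)
  have fold_closed: "foldl h x xs \<in> points G" if "x \<in> points G" "set xs \<subseteq> points G" for x xs
    using that by (induction xs arbitrary: x) (auto simp: closed)
  note iff = theta_iff_of_points[OF N u v, of _ _ \<epsilon> \<delta>]
  show ?thesis
  proof (rule binary_reducible_quotientI[OF nary_congruence_theta[OF m u v N exponent] m, of h])
    show "h x y \<in> points G" if "x \<in> points G" "y \<in> points G" for x y
      using that by (rule closed)
    show "(h x y, h x' y') \<in> theta G u v N \<epsilon> \<delta>"
      if xx: "(x, x') \<in> theta G u v N \<epsilon> \<delta>" and yy: "(y, y') \<in> theta G u v N \<epsilon> \<delta>" for x x' y y'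
    proof -
      have p: "x \<in> points G" "x' \<in> points G" "y \<in> points G" "y' \<in> points G"
        using xx yy by (auto simp: theta_iff[OF N u v])
      have "N #> (tau u v x \<otimes> tau u v y \<otimes> inv w) = N #> (tau u v x' \<otimes> tau u v y' \<otimes> inv w)"
        using p xx yy w by (intro rcos_mult_cong[OF N]) (auto simp: tau iff)
      then show ?thesis
        using xx yy p by (auto simp: iff closed h h_a h_b)
    qed
    show "(h (h x y) z, h x (h y z)) \<in> theta G u v N \<epsilon> \<delta>"
      if p: "x \<in> points G" "y \<in> points G" "z \<in> points G" for x y z
    proof -
      have "N #> (tau u v (h x y) \<otimes> (tau u v z \<otimes> inv w)) =
          N #> (tau u v x \<otimes> tau u v y \<otimes> inv w \<otimes> (tau u v z \<otimes> inv w))"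
        using p w h by (intro rcos_mult_cong[OF N]) (auto simp: tau closed)
      moreover have "N #> (tau u v x \<otimes> inv w \<otimes> tau u v (h y z)) =
          N #> (tau u v x \<otimes> inv w \<otimes> (tau u v y \<otimes> tau u v z \<otimes> inv w))"
        using p w h by (intro rcos_mult_cong[OF N]) (auto simp: tau closed)
      ultimately have "N #> tau u v (h (h x y) z) = N #> tau u v (h x (h y z))"
        using p w by (simp add: h tau closed m_ac)
      then show ?thesis using p by (auto simp: iff closed h_a h_b)
    qed
    show "(F_op G u v xs, foldl h (hd xs) (tl xs)) \<in> theta G u v N \<epsilon> \<delta>"
      if "xs \<in> nary_tuples (points G) m" for xs
    proof -
      have xs: "length xs = m" "set xs \<subseteq> points G" using that by (auto simp: nary_tuples_def)
      obtain y ys where y: "xs = y # ys" using xs m by (cases xs) auto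
      have ne: "y # ys \<noteq> []" by simp
      have "inv w [^] length ys = \<one>" using exponent w xs y by auto
      then have "N #> tau u v (F_op G u v xs) = N #> tau u v (foldl h y ys)"
        using fold xs y tau_F_op[OF xs(2,1) m u v exponent] u v by (simp add: tau foldr_tau_closed)
      then show ?thesis
        using xs F_op_eq_iff[OF ne, of u v] fold_a[of y ys] fold_b[of y ys]
        by (auto simp: y iff fold_closed F_op_closed u v)
    qed
  qed
qed

text \<open>The m - 1 copies of \<open>c\<close> contribute a multiple of m - 1, hence zero, and
  \<open>y \<noteq> c\<close> excludes the two exceptional cases of \<open>F_op\<close>.\<close>

lemma F_op_snoc_replicate:
  assumes "m \<ge> 2" "u \<in> carrier G" "v \<in> carrier G" "c \<in> points G" "y \<in> points G" "y \<noteq> c"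
    and "\<forall>g \<in> carrier G. g [^] (m - 1) = \<one>"
  shows "F_op G u v (replicate (m - 1) c @ [y]) = Elem (tau u v y)"
proof -
  have "foldr (\<lambda>x s. tau u v x \<otimes> s) (replicate (m - 1) c @ [y]) \<one> =
      tau u v c [^] (m - 1) \<otimes> (tau u v y \<otimes> \<one>)"
    using assms foldr_tau_const[of "replicate (m - 1) c" c u v]
    by (subst foldr_tau_append) auto
  moreover have "set (replicate (m - 1) c @ [y]) = {c, y}" using assms(1) by auto
  ultimately show ?thesis using assms by (auto simp: F_op_def tau_closed simp del: foldr_append)
qed

lemma F_op_Cons_replicate:
  assumes "m \<ge> 2" "u \<in> carrier G" "v \<in> carrier G" "c \<in> points G" "y \<in> points G" "y \<noteq> c"
    and "\<forall>g \<in> carrier G. g [^] (m - 1) = \<one>"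
  shows "F_op G u v (y # replicate (m - 1) c) = Elem (tau u v y)"
proof -
  have "foldr (\<lambda>x s. tau u v x \<otimes> s) (replicate (m - 1) c) \<one> = tau u v c [^] (m - 1)"
    using assms foldr_tau_const[of "replicate (m - 1) c" c u v] by auto
  moreover have "set (y # replicate (m - 1) c) = {c, y}" using assms(1) by auto
  ultimately show ?thesis using assms by (auto simp: F_op_def tau_closed)
qed

text \<open>With both flags off, a and b form singleton classes, which the quotient operation
  attains only at constant tuples. So \<open>binary_reducible_distinguished\<close> applies, and
  equating the values at (a, ..., a, b) and (a, b, ..., b) identifies the classes of
  \<open>v\<close> and \<open>u\<close>.\<close>

lemma binary_reducible_F_op_quotient_imp:
  assumes N: "subgroup N G" and u: "u \<in> carrier G" and v: "v \<in> carrier G" and m: "m \<ge> 2"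
    and exponent: "\<forall>g \<in> carrier G. g [^] (m - 1) = \<one>"
    and red: "binary_reducible (points G // theta G u v N False False) m
      (quotient_op (theta G u v N False False) (F_op G u v))"
  shows "u \<otimes> inv v \<in> N"
proof -
  define r where "r = theta G u v N False False"
  define cls where "cls x = r `` {x}" for x
  have cong: "nary_congruence (points G) m (F_op G u v) r"
    unfolding r_def using m u v N exponent by (intro nary_congruence_theta) auto
  then have equiv: "equiv (points G) r" by (simp add: nary_congruence_def)
  have P: "Pt_a \<in> points G" "Pt_b \<in> points G" by (auto simp: points_def)
  have cls_eq: "cls x = cls c \<longleftrightarrow> x = c" if "x \<in> points G" "c \<in> {Pt_a, Pt_b}" for x c
    using that P eq_equiv_class_iff[OF equiv, of x c]
    by (auto simp: cls_def r_def theta_iff[OF N u v])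
  have Q: "quotient_op r (F_op G u v) (map cls xs) = cls (F_op G u v xs)"
    if "xs \<in> nary_tuples (points G) m" for xs
    using quotient_op_eq[OF cong that] by (simp add: cls_def[abs_def])
  have all: "quotient_op r (F_op G u v) Cs = cls c \<longleftrightarrow> set Cs \<subseteq> {cls c}"
    if Cs: "Cs \<in> nary_tuples (points G // r) m" and c: "c \<in> {Pt_a, Pt_b}" for Cs c
  proof -
    obtain xs where xs: "xs \<in> nary_tuples (points G) m" and Cs: "Cs = map cls xs"
      unfolding cls_def[abs_def] using Cs by (rule nary_tuples_quotient)
    have ne: "xs \<noteq> []" and sub: "set xs \<subseteq> points G" using xs m by (auto simp: nary_tuples_def)
    have "cls (F_op G u v xs) = cls c \<longleftrightarrow> (\<forall>x \<in> set xs. x = c)"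
      using c F_op_eq_iff[OF ne] cls_eq F_op_closed[OF sub u v] by auto
    also have "\<dots> \<longleftrightarrow> (\<forall>x \<in> set xs. cls x = cls c)" using c cls_eq sub by blast
    also have "\<dots> \<longleftrightarrow> set Cs \<subseteq> {cls c}" by (auto simp: Cs)
    finally show ?thesis by (simp add: Cs Q[OF xs])
  qed
  have tuples: "replicate (m - 1) Pt_a @ [Pt_b] \<in> nary_tuples (points G) m"
    "Pt_a # replicate (m - 1) Pt_b \<in> nary_tuples (points G) m"
    using P m by (auto simp: nary_tuples_def)
  have "quotient_op r (F_op G u v) (replicate (m - 1) (cls Pt_a) @ [cls Pt_b]) =
      quotient_op r (F_op G u v) (cls Pt_a # replicate (m - 1) (cls Pt_b))"
    by (rule binary_reducible_distinguished[OF red[folded r_def] m])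
      (use P all in \<open>auto simp: cls_def intro: quotientI\<close>)
  then have "cls (Elem v) = cls (Elem u)"
    using Q[OF tuples(1)] Q[OF tuples(2)] F_op_snoc_replicate[OF m u v P _ exponent]
      F_op_Cons_replicate[OF m u v P(2,1) _ exponent]
    by simp
  then have "(Elem u, Elem v) \<in> r"
    using eq_equiv_class_iff[OF equiv, of "Elem u" "Elem v"] u v by (auto simp: cls_def points_def)
  then show ?thesis
    using in_subgroup_iff_rcos_eq[OF N u v] by (auto simp: r_def theta_iff[OF N u v])
qed

lemma binary_reducible_F_op_quotient_iff:
  assumes "subgroup N G" "u \<in> carrier G" "v \<in> carrier G" "m \<ge> 2"
    and "\<forall>g \<in> carrier G. g [^] (m - 1) = \<one>"
  shows "binary_reducible (points G // theta G u v N \<epsilon> \<delta>) m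
      (quotient_op (theta G u v N \<epsilon> \<delta>) (F_op G u v)) \<longleftrightarrow> \<epsilon> \<or> \<delta> \<or> u \<otimes> inv v \<in> N"
    (is "?L \<longleftrightarrow> ?R")
proof
  assume ?L
  then show ?R
    using binary_reducible_F_op_quotient_imp[OF assms] by (cases \<epsilon>; cases \<delta>) auto
next
  assume ?R
  then show ?L using assms(4) by (intro binary_reducible_F_op_quotientI assms) auto
qed

section \<open>The congruences of the operation\<close>

text \<open>The relation joins each element of \<open>N\<close> to the neutral element, a to
  \<open>u\<close> if \<epsilon> holds, and b to \<open>v\<close> if \<delta> holds. Each of these
  is a pair of distinct points unless it joins the neutral element to itself.\<close>

lemma theta_eq_Id_on_iff:
  assumes N: "subgroup N G" and "u \<in> carrier G" "v \<in> carrier G"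
  shows "theta G u v N \<epsilon> \<delta> = Id_on (points G) \<longleftrightarrow> N = {\<one>} \<and> \<not> \<epsilon> \<and> \<not> \<delta>"
proof
  note iff = theta_iff[OF assms]
  assume id: "theta G u v N \<epsilon> \<delta> = Id_on (points G)"
  have "(Pt_a, Elem u) \<notin> theta G u v N \<epsilon> \<delta>" "(Pt_b, Elem v) \<notin> theta G u v N \<epsilon> \<delta>"
    unfolding id by auto
  then have "\<not> \<epsilon>" "\<not> \<delta>" using assms by (auto simp: iff points_def)
  moreover have "x = \<one>" if "x \<in> N" for x
  proof -
    have "x \<in> carrier G" using that subgroup.mem_carrier[OF N] by simp
    then have "(Elem x, Elem \<one>) \<in> theta G u v N \<epsilon> \<delta>"
      using that in_subgroup_iff_rcos_eq[OF N, of x \<one>] by (simp add: iff points_def)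
    then show ?thesis unfolding id by auto
  qed
  ultimately show "N = {\<one>} \<and> \<not> \<epsilon> \<and> \<not> \<delta>" using subgroup.one_closed[OF N] by blast
next
  assume *: "N = {\<one>} \<and> \<not> \<epsilon> \<and> \<not> \<delta>"
  have "N #> x = {x}" if "x \<in> carrier G" for x
    using that * by (simp add: r_coset_def)
  then have coset: "N #> tau u v x = N #> tau u v y \<longleftrightarrow> tau u v x = tau u v y"
    if "x \<in> points G" "y \<in> points G" for x y
    using that assms by (simp add: tau_closed)
  have "(x, y) \<in> theta G u v N \<epsilon> \<delta> \<longleftrightarrow> (x, y) \<in> Id_on (points G)" for x y
    unfolding theta_iff[OF assms] using * coset[of x y]
    by (cases x; cases y) (auto simp: Id_on_iff)
  then show "theta G u v N \<epsilon> \<delta> = Id_on (points G)" by (simp add: set_eq_iff split_paired_all)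
qed

text \<open>On G the congruence is invariant under translations, hence is congruence modulo the
  class \<open>N\<close> of the neutral element. If a is related to any other point, then it is
  related to \<open>u\<close>, and this decides \<epsilon>; likewise b, \<open>v\<close> and
  \<delta>.\<close>

lemma nary_congruence_F_op_eq_theta:
  assumes cong: "nary_congruence (points G) m (F_op G u v) r"
    and u: "u \<in> carrier G" and v: "v \<in> carrier G" and m: "m \<ge> 3"
    and exponent: "\<forall>g \<in> carrier G. g [^] (m - 1) = \<one>"
  shows "\<exists>N \<epsilon> \<delta>. subgroup N G \<and> r = theta G u v N \<epsilon> \<delta>"
proof -
  have equiv: "equiv (points G) r"
    and F: "\<And>xs ys. xs \<in> nary_tuples (points G) m \<Longrightarrow> ys \<in> nary_tuples (points G) m \<Longrightarrow>
      list_all2 (\<lambda>x y. (x, y) \<in> r) xs ys \<Longrightarrow> (F_op G u v xs, F_op G u v ys) \<in> r"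
    using cong by (auto simp: nary_congruence_def)
  have refl: "(x, x) \<in> r" if "x \<in> points G" for x
    using equiv that by (auto simp: equiv_def refl_on_def)
  have sym: "(x, y) \<in> r \<Longrightarrow> (y, x) \<in> r" for x y
    using equiv by (auto simp: equiv_def sym_def)
  have trans: "(x, y) \<in> r \<Longrightarrow> (y, z) \<in> r \<Longrightarrow> (x, z) \<in> r" for x y z
    using equiv by (auto simp: equiv_def trans_def)
  have in_points: "x \<in> points G" "y \<in> points G" if "(x, y) \<in> r" for x y
    using that equiv by (auto simp: equiv_def)
  have P: "Pt_a \<in> points G" "Pt_b \<in> points G" "\<And>g. Elem g \<in> points G \<longleftrightarrow> g \<in> carrier G"
    by (auto simp: points_def)
  have m': "m \<ge> 2" using m by simp
  have translate: "(Elem (x \<otimes> z), Elem (y \<otimes> z)) \<in> r"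
    if "(Elem x, Elem y) \<in> r" "z \<in> carrier G" for x y z
  proof -
    have xy: "x \<in> carrier G" "y \<in> carrier G" using in_points[OF that(1)] P by auto
    \<comment> \<open>Padding with neutral elements turns the m-ary operation into the addition of
      G.\<close>
    have op: "F_op G u v (Elem g # Elem z # replicate (m - 2) (Elem \<one>)) = Elem (g \<otimes> z)"
      if "g \<in> carrier G" for g
      using that \<open>z \<in> carrier G\<close> foldr_tau_const[of "replicate (m - 2) (Elem \<one>)" "Elem \<one>" u v] u v P
      by (simp add: F_op_def)
    have "list_all2 (\<lambda>x y. (x, y) \<in> r) (Elem x # Elem z # replicate (m - 2) (Elem \<one>))
        (Elem y # Elem z # replicate (m - 2) (Elem \<one>))"
      using that refl P by (simp add: list_all2_same)
    then show ?thesis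
      using F[of "Elem x # Elem z # replicate (m - 2) (Elem \<one>)"
          "Elem y # Elem z # replicate (m - 2) (Elem \<one>)"] xy that P m
      by (auto simp: op nary_tuples_def)
  qed
  define N where "N = {g \<in> carrier G. (Elem g, Elem \<one>) \<in> r}"
  have r_Elem: "(Elem x, Elem y) \<in> r \<longleftrightarrow> x \<otimes> inv y \<in> N"
    if "x \<in> carrier G" "y \<in> carrier G" for x y
  proof
    assume "(Elem x, Elem y) \<in> r"
    then show "x \<otimes> inv y \<in> N" using translate[of x y "inv y"] that by (simp add: N_def)
  next
    assume "x \<otimes> inv y \<in> N"
    then have "(Elem (x \<otimes> inv y \<otimes> y), Elem (\<one> \<otimes> y)) \<in> r"
      using that by (intro translate) (auto simp: N_def)
    then show "(Elem x, Elem y) \<in> r" using that by (simp add: m_assoc)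
  qed
  have N: "subgroup N G"
  proof (rule subgroupI)
    show "N \<subseteq> carrier G" by (auto simp: N_def)
    show "N \<noteq> {}" using refl P by (auto simp: N_def)
    show "inv x \<in> N" if "x \<in> N" for x
      using that r_Elem[of \<one> x] sym by (auto simp: N_def)
    show "x \<otimes> y \<in> N" if "x \<in> N" "y \<in> N" for x y
      using that translate[of x \<one> y] trans by (auto simp: N_def)
  qed
  \<comment> \<open>Replacing the last entry of (c, ..., c) by \<open>y\<close> relates
    \<open>c\<close> to the group element \<open>g = tau u v y\<close>. Replacing all entries but
    the first by \<open>g\<close> then relates \<open>c\<close> to \<open>tau u v c\<close>, because
    m - 1 copies of \<open>g\<close> add up to zero.\<close>
  have special: "(c, Elem (tau u v c)) \<in> r"
    if c: "c \<in> {Pt_a, Pt_b}" and cy: "(c, y) \<in> r" "y \<noteq> c" for c y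
  proof -
    have y: "y \<in> points G" "c \<in> points G" using in_points cy by auto
    define g where "g = tau u v y"
    have g: "Elem g \<in> points G" "Elem g \<noteq> c" using y u v c by (auto simp: g_def tau_closed P)
    have c_eq: "F_op G u v (replicate (m - 1) c @ [c]) = c" "F_op G u v (c # replicate (m - 1) c) = c"
      using c by (auto simp: F_op_def)
    have "list_all2 (\<lambda>x y. (x, y) \<in> r) (replicate (m - 1) c @ [c]) (replicate (m - 1) c @ [y])"
      using cy refl y by (auto simp: list_all2_conv_all_nth nth_append)
    then have "(F_op G u v (replicate (m - 1) c @ [c]), F_op G u v (replicate (m - 1) c @ [y])) \<in> r"
      using y m by (intro F) (auto simp: nary_tuples_def)
    then have cg: "(c, Elem g) \<in> r"
      using F_op_snoc_replicate[OF m' u v y(2,1) cy(2) exponent] c_eq by (simp add: g_def)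
    then have "list_all2 (\<lambda>x y. (x, y) \<in> r) (c # replicate (m - 1) c) (c # replicate (m - 1) (Elem g))"
      using refl y by (auto simp: list_all2_conv_all_nth nth_Cons')
    then have "(F_op G u v (c # replicate (m - 1) c), F_op G u v (c # replicate (m - 1) (Elem g))) \<in> r"
      using y g m by (intro F) (auto simp: nary_tuples_def)
    then show ?thesis
      using F_op_Cons_replicate[OF m' u v g(1) y(2) g(2)[symmetric] exponent] c_eq by simp
  qed
  define \<epsilon> \<delta> where "\<epsilon> \<longleftrightarrow> (Pt_a, Elem u) \<in> r" and "\<delta> \<longleftrightarrow> (Pt_b, Elem v) \<in> r"
  \<comment> \<open>\<open>adj x\<close> amounts to \<open>x\<close> being related to its image in
    G. Two distinct related points both have this property, so \<open>r\<close> is determined by its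
    restriction to G together with \<epsilon> and \<delta>.\<close>
  define adj where "adj x \<longleftrightarrow> (\<epsilon> \<or> x \<noteq> Pt_a) \<and> (\<delta> \<or> x \<noteq> Pt_b)" for x :: "'a point"
  have adj: "(x, Elem (tau u v x)) \<in> r \<longleftrightarrow> adj x" if "x \<in> points G" for x
    using that refl by (cases x) (auto simp: adj_def \<epsilon>_def \<delta>_def)
  have adjI: "adj x" if "(x, y) \<in> r" "x \<noteq> y" for x y
    using that special[of x y] by (cases x) (auto simp: adj_def \<epsilon>_def \<delta>_def)
  have "(x, y) \<in> r \<longleftrightarrow> (x, y) \<in> theta G u v N \<epsilon> \<delta>" for x y
  proof (cases "x \<in> points G \<and> y \<in> points G \<and> x \<noteq> y")
    case True
    then have carrier: "tau u v x \<in> carrier G" "tau u v y \<in> carrier G"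
      using u v by (auto simp: tau_closed)
    have "(x, y) \<in> theta G u v N \<epsilon> \<delta> \<longleftrightarrow> (Elem (tau u v x), Elem (tau u v y)) \<in> r \<and> adj x \<and> adj y"
      using True carrier
      by (auto simp: theta_iff[OF N u v] adj_def r_Elem in_subgroup_iff_rcos_eq[OF N])
    moreover have "adj x \<and> adj y" if "(x, y) \<in> r"
      using adjI[of x y] adjI[of y x] that True sym by blast
    ultimately show ?thesis
      using adj True sym trans by metis
  next
    case False
    then show ?thesis using refl in_points by (auto simp: theta_iff[OF N u v])
  qed
  then have "r = theta G u v N \<epsilon> \<delta>" by auto
  then show ?thesis using N by blast
qed

section \<open>Finite abelian groups with an element in every nontrivial subgroup\<close>

text \<open>Any element of prime order generates a subgroup containing \<open>d\<close>, so only one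
  prime p = \<open>ord d\<close> occurs and all orders are powers of p. It then remains to see that
  an element \<open>c\<close> of maximal order generates G.\<close>

lemma monolith_imp_cyclic_prime_power:
  assumes fin: "finite (carrier G)" and d: "d \<in> carrier G" "d \<noteq> \<one>"
    and monolith: "\<And>N. subgroup N G \<Longrightarrow> N \<noteq> {\<one>} \<Longrightarrow> d \<in> N"
  obtains p k where "prime (p::nat)" "k \<ge> 1" "cyclic_group G" "order G = p ^ k" "ord d = p"
proof -
  have pos: "ord x > 0" if "x \<in> carrier G" for x
    using ord_ge_1[OF fin that] by simp
  \<comment> \<open>Some power \<open>y\<close> of \<open>x\<close> has order \<open>q\<close>. As
    \<open>d\<close> is a power of \<open>y\<close> and is not neutral, it has order
    \<open>q\<close> too.\<close>
  have prime_ord: "ord d = q" if x: "x \<in> carrier G" and q: "prime q" "q dvd ord x" for x q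
  proof -
    obtain y where y: "y \<in> carrier G" "ord y = q"
      using exists_elem_of_prime_order[OF x subgroup_self q fin] by blast
    then have "y \<noteq> \<one>" using q by auto
    then have "d \<in> range (\<lambda>n::int. y [^] n)"
      using monolith[OF subgroup_of_powers[OF y(1)]] y int_pow_1[OF y(1)] by (metis rangeI singletonD)
    then obtain n :: int where "d = y [^] n" by blast
    then have "d [^] q = \<one>"
      using y(1) y(2) by (metis int_pow_int int_pow_pow int_pow_eq_id dvd_triv_right)
    then have "ord d dvd q" using d by (simp add: pow_eq_id)
    then show ?thesis
      using q d ord_eq_1 by (auto simp: prime_nat_iff)
  qed
  have "ord d \<noteq> 1" using d ord_eq_1 by simp
  then obtain p where p: "prime p" "p dvd ord d" using prime_factor_nat by blast
  have ord_d: "ord d = p" using prime_ord[OF d(1) p] .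
  have p_power: "\<exists>j. ord x = p ^ j" if x: "x \<in> carrier G" for x
  proof -
    have "q = p" if "prime q" "q dvd ord x" for q
      using prime_ord[OF x that] ord_d by simp
    obtain y where y: "ord x = p ^ multiplicity p (ord x) * y" "\<not> p dvd y"
      using multiplicity_decompose'[of "ord x" p] pos[OF x] p(1)
      by (metis less_numeral_extra(3) not_prime_unit)
    have "y = 1"
    proof (rule ccontr)
      assume "y \<noteq> 1"
      then obtain q where "prime q" "q dvd y" using prime_factor_nat by blast
      then show False using \<open>\<And>q. prime q \<Longrightarrow> q dvd ord x \<Longrightarrow> q = p\<close> y by (metis dvd_mult)
    qed
    then show ?thesis using y by auto
  qed
  obtain c where c: "c \<in> carrier G" and c_max: "\<And>x. x \<in> carrier G \<Longrightarrow> ord x \<le> ord c"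
  proof -
    have "Max (ord ` carrier G) \<in> ord ` carrier G" using fin d by (intro Max_in) auto
    then obtain c where "c \<in> carrier G" "ord c = Max (ord ` carrier G)" by auto
    then show thesis using that[of c] fin by simp
  qed
  obtain j where j: "ord c = p ^ j" using p_power[OF c] by blast
  define C where "C = range (\<lambda>n::int. c [^] n)"
  have C: "subgroup C G" "c \<in> C"
    unfolding C_def using subgroup_of_powers[OF c] c by (auto, metis int_pow_1 rangeI)
  have "j \<noteq> 0"
    using c_max[OF d(1)] ord_d j prime_gt_1_nat[OF p(1)] by (intro notI) simp
  then have "c \<noteq> \<one>" using j one_less_power[OF prime_gt_1_nat[OF p(1)], of j] by auto
  then have "d \<in> C" using monolith C by auto
  \<comment> \<open>An element \<open>x\<close> of least order outside \<open>C\<close> would have \<open>x\<^sup>p \<in> C\<close>, and \<open>x\<^sup>p\<close> is even a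
    \<open>p\<close>-th power in \<open>C\<close> because \<open>ord x\<close> divides \<open>ord c\<close>. Dividing by that root leaves an element
    of order \<open>p\<close>, whose powers contain \<open>d\<close> and hence are the powers of \<open>d\<close>.\<close>
  have "x \<in> C" if "x \<in> carrier G" for x
    using that
  proof (induction "ord x" arbitrary: x rule: less_induct)
    case less
    obtain i where i: "ord x = p ^ i" using p_power less.prems by blast
    show ?case
    proof (cases "x = \<one>")
      case True
      then show ?thesis using C subgroup.one_closed by blast
    next
      case False
      then have "i \<noteq> 0" using i less.prems ord_eq_1 by (intro notI) simp
      then obtain i' where i': "i = Suc i'" by (cases i) auto
      have ord_xp: "ord (x [^] p) = p ^ i'"
        using ord_pow[of x p] less.prems p i i' by (auto simp: prime_gt_0_nat)
      then have "x [^] p \<in> C"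
        using less.hyps less.prems i i' prime_gt_1_nat[OF p(1)] by simp
      then obtain r :: int where r: "x [^] p = c [^] r" by (auto simp: C_def)
      have ij: "i \<le> j" using c_max[OF less.prems] i j prime_gt_1_nat[OF p(1)] by simp
      obtain j' where j': "j = Suc j'" using \<open>j \<noteq> 0\<close> by (cases j) auto
      \<comment> \<open>Here \<open>j' = j - 1\<close>. Since the order of \<open>x [^] p\<close>
        divides \<open>p ^ j'\<close>, this power is neutral; so \<open>p ^ j\<close> divides
        \<open>r * p ^ j'\<close>, whence \<open>p\<close> divides \<open>r\<close> and
        \<open>c [^] (r div p)\<close> is the required root.\<close>
      have "c [^] (r * int (p ^ j')) = (x [^] p) [^] (p ^ j')"
        using c r by (simp add: int_pow_pow flip: int_pow_int)
      also have "\<dots> = \<one>"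
        using less.prems ord_xp ij i' j' by (simp add: pow_eq_id le_imp_power_dvd)
      finally have "int (p ^ j) dvd r * int (p ^ j')"
        using c j by (simp add: int_pow_eq_id)
      then have "int p dvd r" using j' p by simp
      then obtain s where s: "r = int p * s" by blast
      define y where "y = x \<otimes> inv (c [^] s)"
      have y: "y \<in> carrier G" using less.prems c by (simp add: y_def)
      have "y [^] p = x [^] p \<otimes> inv ((c [^] s) [^] p)"
        using less.prems c by (simp add: y_def pow_mult_distrib m_comm nat_pow_inv)
      also have "(c [^] s) [^] p = x [^] p"
        unfolding r s using c by (simp only: int_pow_pow mult.commute[of "int p"] flip: int_pow_int)
      finally have yp: "y [^] p = \<one>" using less.prems by simp
      have "y \<in> C"
      proof (cases "y = \<one>")
        case True
        then show ?thesis using C subgroup.one_closed by blast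
      next
        case False
        then have "ord y = p" using yp y p ord_eq_1 by (auto simp: pow_eq_id prime_nat_iff)
        have "d \<in> range (\<lambda>n::int. y [^] n)"
          using monolith[OF subgroup_of_powers[OF y]] False int_pow_1[OF y] by (metis rangeI singletonD)
        then obtain n :: int where n: "d = y [^] n" by blast
        \<comment> \<open>Otherwise \<open>d\<close> would be neutral. So \<open>n\<close> is
          invertible modulo \<open>p = ord y\<close>, and the inverse exponent writes
          \<open>y\<close> as a power of \<open>d\<close>.\<close>
        have "\<not> int p dvd n" using n d y \<open>ord y = p\<close> int_pow_eq_id by auto
        then have "coprime (int p) n" using p by (simp add: prime_imp_coprime)
        then obtain a b where "a * int p + b * n = 1" using bezout_int[of "int p" n] by auto
        then have "y = y [^] (int p * a + n * b)" using y by (simp add: mult.commute)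
        also have "\<dots> = (y [^] int p) [^] a \<otimes> d [^] b"
          using y by (simp only: n int_pow_mult int_pow_pow)
        also have "\<dots> = d [^] b" using yp d by (simp add: int_pow_int)
        finally show ?thesis
          using \<open>d \<in> C\<close> C(1) subgroup_int_pow_closed by metis
      qed
      moreover have "c [^] s \<in> C" by (simp add: C_def)
      ultimately have "y \<otimes> c [^] s \<in> C" by (rule subgroup.m_closed[OF C(1)])
      then show ?thesis using less.prems c by (simp add: y_def m_assoc)
    qed
  qed
  then have carrier: "carrier G = C" using subgroup.subset[OF C(1)] by auto
  have "cyclic_group G" unfolding cyclic_group using c carrier[unfolded C_def] by (rule bexI[rotated])
  moreover have "order G = p ^ j"
    using cyclic_order_is_ord[OF c] carrier j
    by (simp add: order_def carrier_subgroup_generated_by_singleton[OF c] C_def)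
  ultimately show thesis
    using that[of p j] p(1) ord_d \<open>j \<noteq> 0\<close> by simp
qed

text \<open>Let \<open>c\<close> generate G, let \<open>d = c [^] t\<close>, and let
  \<open>x = c [^] r\<close> be a nontrivial element of \<open>N\<close>. Then
  \<open>p ^ (k - 1)\<close> divides \<open>t\<close>, while the gcd of \<open>r\<close> and
  \<open>p ^ k\<close> is \<open>p ^ i\<close> with \<open>i < k\<close>. So this gcd divides
  \<open>t\<close>, and Bezout coefficients write \<open>d\<close> as a power of
  \<open>x\<close>.\<close>

lemma cyclic_prime_power_imp_monolith:
  assumes p: "prime (p::nat)" and cyc: "cyclic_group G" and order: "order G = p ^ k"
    and d: "d \<in> carrier G" "ord d = p" and N: "subgroup N G" "N \<noteq> {\<one>}"
  shows "d \<in> N"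
proof -
  obtain c where c: "c \<in> carrier G" and carrier: "carrier G = range (\<lambda>n::int. c [^] n)"
    using cyc by (auto simp: cyclic_group)
  have ord_c: "ord c = p ^ k"
    using cyclic_order_is_ord[OF c] carrier order
    by (simp add: order_def carrier_subgroup_generated_by_singleton[OF c])
  obtain t :: int where t: "d = c [^] t" using d carrier by blast
  obtain x where x: "x \<in> N" "x \<noteq> \<one>" using N(2) subgroup.one_closed[OF N(1)] by blast
  have "x \<in> range (\<lambda>n::int. c [^] n)"
    using subgroup.mem_carrier[OF N(1) x(1)] unfolding carrier .
  then obtain r :: int where r: "x = c [^] r" by blast
  have "\<not> int (p ^ k) dvd r" using x r c ord_c by (simp add: int_pow_eq_id)
  have "c [^] (t * int p) = \<one>" using d t c
    by (metis int_pow_int int_pow_pow pow_ord_eq_1)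
  then have "int (p ^ k) dvd t * int p" using c ord_c by (simp add: int_pow_eq_id)
  \<comment> \<open>Divisors of \<open>p ^ k\<close> are powers of \<open>p\<close>. This is applied
    to natural numbers, hence the absolute value of the integer \<open>r\<close>.\<close>
  obtain i where i: "i \<le> k" "gcd (nat \<bar>r\<bar>) (p ^ k) = p ^ i"
    by (metis divides_primepow_nat[OF p] gcd_dvd2)
  have gcd: "gcd r (int (p ^ k)) = int p ^ i"
    unfolding gcd_int_def abs_of_nat nat_int i(2) by (rule of_nat_power)
  then have "i < k" using \<open>\<not> int (p ^ k) dvd r\<close> i
    by (metis gcd_dvd1 le_neq_implies_less of_nat_power)
  then obtain l where l: "k = Suc l" "i \<le> l" by (cases k) auto
  then have "int p ^ l dvd t"
    using \<open>int (p ^ k) dvd t * int p\<close> prime_gt_0_nat[OF p] by (simp add: mult.commute)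
  then have "int p ^ i dvd t" using l(2) le_imp_power_dvd dvd_trans by blast
  then obtain s where s: "t = int p ^ i * s" by blast
  obtain a b where ab: "a * r + b * int (p ^ k) = int p ^ i" using bezout_int gcd by metis
  have "t = r * (a * s) + int (p ^ k) * (b * s)"
    unfolding s ab[symmetric] by (simp only: algebra_simps)
  then have "d = c [^] (r * (a * s) + int (p ^ k) * (b * s))" using t by simp
  also have "\<dots> = x [^] (a * s) \<otimes> (c [^] int (p ^ k)) [^] (b * s)"
    using c by (simp only: r int_pow_mult int_pow_pow)
  also have "c [^] int (p ^ k) = \<one>" using c ord_c by (simp add: int_pow_eq_id)
  finally have "d = x [^] (a * s)" using subgroup.mem_carrier[OF N(1) x(1)] by simp
  then show ?thesis using subgroup_int_pow_closed[OF N(1) x(1)] by simp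
qed

end

theorem theorem5p2:
  fixes G :: "('g, 'r) monoid_scheme" (structure)
    and m :: nat and u v d :: 'g
  assumes "m \<ge> 3" and "odd m"
    and "comm_group G"
    and "\<forall>g \<in> carrier G. g [^] (m - 1) = \<one>"
    and "u \<in> carrier G" and "v \<in> carrier G"
    and "d = u \<otimes> inv v"
  shows "(binary_reducible (points G) m (F_op G u v) \<longleftrightarrow> d = \<one>) \<and>
    (\<forall>N \<epsilon> \<delta>. subgroup N G \<longrightarrow>
       (binary_reducible (points G // theta G u v N \<epsilon> \<delta>) m (quotient_op (theta G u v N \<epsilon> \<delta>) (F_op G u v))
          \<longleftrightarrow> \<epsilon> \<or> \<delta> \<or> d \<in> N)) \<and>
    (quotient_critically_irreducible (points G) m (F_op G u v)
       \<longleftrightarrow> d \<noteq> \<one> \<and> (\<forall>N. subgroup N G \<and> N \<noteq> {\<one>} \<longrightarrow> d \<in> N)) \<and>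
    (finite (carrier G) \<longrightarrow>
       (d \<noteq> \<one> \<and> (\<forall>N. subgroup N G \<and> N \<noteq> {\<one>} \<longrightarrow> d \<in> N)
          \<longleftrightarrow> (\<exists>(p::nat) (k::nat). prime p \<and> k \<ge> 1 \<and> cyclic_group G \<and> order G = p ^ k \<and>
                 group.ord G d = p)))"
proof -
  interpret comm_group G by fact
  have m: "m \<ge> 1" "m \<ge> 2" using \<open>m \<ge> 3\<close> by auto
  note exponent = \<open>\<forall>g \<in> carrier G. g [^] (m - 1) = \<one>\<close>
  note u = \<open>u \<in> carrier G\<close> and v = \<open>v \<in> carrier G\<close>
  have d: "d \<in> carrier G" using u v \<open>d = u \<otimes> inv v\<close> by simp
  have quotient: "binary_reducible (points G // theta G u v N \<epsilon> \<delta>) m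
      (quotient_op (theta G u v N \<epsilon> \<delta>) (F_op G u v)) \<longleftrightarrow> \<epsilon> \<or> \<delta> \<or> d \<in> N"
    if "subgroup N G" for N \<epsilon> \<delta>
    using binary_reducible_F_op_quotient_iff[OF that u v m(2) exponent] \<open>d = u \<otimes> inv v\<close> by simp
  \<comment> \<open>The criterion for \<open>F_op\<close> itself is the quotient criterion at the
    identity congruence.\<close>
  have Id: "theta G u v {\<one>} False False = Id_on (points G)"
    using theta_eq_Id_on_iff[OF triv_subgroup u v] by simp
  have "nary_congruence (points G) m (F_op G u v) (Id_on (points G))"
    using nary_congruence_theta[OF m(1) u v triv_subgroup exponent] Id by metis
  then have reducible: "binary_reducible (points G) m (F_op G u v) \<longleftrightarrow> d = \<one>"
    using quotient[OF triv_subgroup, of False False] binary_reducible_quotient_Id_on m(1)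
    unfolding Id by blast
  have critical: "quotient_critically_irreducible (points G) m (F_op G u v)
      \<longleftrightarrow> d \<noteq> \<one> \<and> (\<forall>N. subgroup N G \<and> N \<noteq> {\<one>} \<longrightarrow> d \<in> N)"
  proof
    assume crit: "quotient_critically_irreducible (points G) m (F_op G u v)"
    have "d \<in> N" if N: "subgroup N G" "N \<noteq> {\<one>}" for N
    proof -
      \<comment> \<open>With both flags off, a reducible quotient is possible only if
        \<open>d\<close> lies in \<open>N\<close>, so this choice of congruence extracts the
        condition on \<open>N\<close>.\<close>
      have "theta G u v N False False \<noteq> Id_on (points G)"
        using theta_eq_Id_on_iff[OF N(1) u v] N(2) by blast
      then have "binary_reducible (points G // theta G u v N False False) m
          (quotient_op (theta G u v N False False) (F_op G u v))"
        using crit nary_congruence_theta[OF m(1) u v N(1) exponent]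
        unfolding quotient_critically_irreducible_def by metis
      then show ?thesis using quotient[OF N(1)] by simp
    qed
    then show "d \<noteq> \<one> \<and> (\<forall>N. subgroup N G \<and> N \<noteq> {\<one>} \<longrightarrow> d \<in> N)"
      using crit reducible
      by (auto simp: quotient_critically_irreducible_def irreducible_nary_semigroup_def)
  next
    assume *: "d \<noteq> \<one> \<and> (\<forall>N. subgroup N G \<and> N \<noteq> {\<one>} \<longrightarrow> d \<in> N)"
    have "binary_reducible (points G // r) m (quotient_op r (F_op G u v))"
      if r: "nary_congruence (points G) m (F_op G u v) r" "r \<noteq> Id_on (points G)" for r
    proof -
      obtain N \<epsilon> \<delta> where N: "subgroup N G" and r_eq: "r = theta G u v N \<epsilon> \<delta>"
        using nary_congruence_F_op_eq_theta[OF r(1) u v \<open>m \<ge> 3\<close> exponent] by blast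
      \<comment> \<open>A nonidentity \<open>theta\<close> with both flags off has a nontrivial
        \<open>N\<close>, which contains \<open>d\<close> by assumption.\<close>
      have "\<epsilon> \<or> \<delta> \<or> d \<in> N" using r(2) theta_eq_Id_on_iff[OF N u v] * N unfolding r_eq by metis
      then show ?thesis unfolding r_eq using quotient[OF N] by simp
    qed
    then show "quotient_critically_irreducible (points G) m (F_op G u v)"
      using * reducible nary_semigroup_F_op[OF m(1) u v exponent]
      by (simp add: quotient_critically_irreducible_def irreducible_nary_semigroup_def)
  qed
  have finite: "d \<noteq> \<one> \<and> (\<forall>N. subgroup N G \<and> N \<noteq> {\<one>} \<longrightarrow> d \<in> N) \<longleftrightarrow>
      (\<exists>(p::nat) (k::nat). prime p \<and> k \<ge> 1 \<and> cyclic_group G \<and> order G = p ^ k \<and> ord d = p)"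
    if "finite (carrier G)"
  proof
    assume "d \<noteq> \<one> \<and> (\<forall>N. subgroup N G \<and> N \<noteq> {\<one>} \<longrightarrow> d \<in> N)"
    then show "\<exists>(p::nat) (k::nat). prime p \<and> k \<ge> 1 \<and> cyclic_group G \<and> order G = p ^ k \<and> ord d = p"
      using monolith_imp_cyclic_prime_power[OF that d] by metis
  next
    assume "\<exists>(p::nat) (k::nat). prime p \<and> k \<ge> 1 \<and> cyclic_group G \<and> order G = p ^ k \<and> ord d = p"
    then obtain p k where p: "prime (p::nat)" "cyclic_group G" "order G = p ^ k" "ord d = p"
      by blast
    then have "d \<noteq> \<one>" using ord_eq_1[OF d] by auto
    then show "d \<noteq> \<one> \<and> (\<forall>N. subgroup N G \<and> N \<noteq> {\<one>} \<longrightarrow> d \<in> N)"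
      using cyclic_prime_power_imp_monolith[OF p(1-3) d p(4)] by blast
  qed
  show ?thesis using reducible quotient critical finite by blast
qed

end
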